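(* Let $A,B,C$ be real $n\times n$ matrices. Suppose that $A$ is positive definite, i.e. $x^{\top}Ax>0$ for all $x\in\mathbb{R}^n\setminus\{0\}$ ($A$ not necessarily symmetric), and that the co-hyperbolic condition $$(x^{\top}Bx)^2\ge 4(x^{\top}Ax)(x^{\top}Cx)\quad\text{for all } x\in\mathbb{R}^n,\ x\ge0,$$ holds. Then the $\lambda$-component of any solution $(\lambda,x)$ of QEiCP$(A,B,C)$ satisfies $$l=\beta-\sqrt{\alpha}\ \le\ \lambda\ \le\ \gamma+\sqrt{\alpha}=u,$$ with $a=\lambda_{\min}(A+A^{\top})/2$, $\bar a=\lambda_{\max}(A+A^{\top})/2$, $b=\lambda_{\min}(-B-B^{\top})/2$, $\bar b=\lambda_{\max}(-B-B^{\top})/2$, $\bar c=\lambda_{\max}(-C-C^{\top})/2$, $\alpha=\max\{\gamma^2,\beta^2\}+\bar c/a$, and $$\beta=\begin{cases} b/(2\bar a), & \text{if } b>0;\\ b/(2a), & \text{if } b\le0,\end{cases}\qquad \gamma=\begin{cases}\bar b/(2a), & \text{if }\bar b>0;\\ \bar b/(2\bar a), & \text{if }\bar b\le0.\end{cases}$$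
   Context: $\lambda_{\max}(M)$ (resp. $\lambda_{\min}(M)$) denotes the largest (resp. smallest) real eigenvalue of the matrix $M$. Vector inequalities are componentwise. The Quadratic Eigenvalue Complementarity Problem QEiCP$(A,B,C)$ consists of finding $\lambda\in\mathbb{R}$ and $x\in\mathbb{R}^n\setminus\{0\}$ such that, with $w=\lambda^2Ax+\lambda Bx+Cx$, one has $x\ge0$, $w\ge0$ and $x^{\top}w=0$; such a pair $(\lambda,x)$ is a solution. *)

theory Defs
  imports "HOL-Analysis.Analysis"
begin

definition eigenvalue :: "real^'n^'n \<Rightarrow> real \<Rightarrow> bool" where
  "eigenvalue M k \<longleftrightarrow> (\<exists>v. v \<noteq> 0 \<and> M *v v = k *\<^sub>R v)"

(* Unspecified when M has no real eigenvalue; only symmetric matrices are of interest here. *)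

definition lambda_max :: "real^'n^'n \<Rightarrow> real" where
  "lambda_max M = (GREATEST k. eigenvalue M k)"

definition lambda_min :: "real^'n^'n \<Rightarrow> real" where
  "lambda_min M = (LEAST k. eigenvalue M k)"

(* Symmetry is deliberately not required. *)

definition positive_definite :: "real^'n^'n \<Rightarrow> bool" where
  "positive_definite A \<longleftrightarrow> (\<forall>x. x \<noteq> 0 \<longrightarrow> x \<bullet> (A *v x) > 0)"

(* The order on real^'n is the componentwise one (less_eq_vec_def), here and below. *)

definition co_hyperbolic :: "real^'n^'n \<Rightarrow> real^'n^'n \<Rightarrow> real^'n^'n \<Rightarrow> bool" where
  "co_hyperbolic A B C \<longleftrightarrow>
     (\<forall>x. x \<ge> 0 \<longrightarrow> (x \<bullet> (B *v x))\<^sup>2 \<ge> 4 * (x \<bullet> (A *v x)) * (x \<bullet> (C *v x)))"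

definition qeicp_solution ::
  "real^'n^'n \<Rightarrow> real^'n^'n \<Rightarrow> real^'n^'n \<Rightarrow> real \<Rightarrow> real^'n \<Rightarrow> bool" where
  "qeicp_solution A B C l x \<longleftrightarrow>
     x \<noteq> 0 \<and>
     (let w = l\<^sup>2 *\<^sub>R (A *v x) + l *\<^sub>R (B *v x) + C *v x
      in x \<ge> 0 \<and> w \<ge> 0 \<and> x \<bullet> w = 0)"

end

theory Submission
  imports Defs
begin

text \<open>
  A solution \<open>(\<lambda>, x)\<close> satisfies the scalar equation \<open>p \<lambda>\<^sup>2 + q \<lambda> + r = 0\<close>, where \<open>p\<close>, \<open>q\<close>, \<open>r\<close> are the
  quadratic forms of \<open>A\<close>, \<open>B\<close>, \<open>C\<close> at \<open>x\<close> divided by \<open>x \<bullet> x\<close>. A matrix and its symmetric part have the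
  same quadratic form, so Rayleigh's principle (\<open>lambda_max_quadratic_form\<close>,
  \<open>lambda_min_quadratic_form\<close>) gives \<open>a \<le> p \<le> a'\<close>, \<open>b \<le> - q \<le> b'\<close> and \<open>- r \<le> c'\<close>, with \<open>0 < a\<close> by
  positive definiteness.

  Let \<open>m = - q / (2 p)\<close> be the midpoint of the two roots. The two-case definitions of \<open>\<beta>\<close> and
  \<open>\<gamma>\<close> are the extreme values of such a quotient over the box given by the Rayleigh bounds, so
  \<open>\<beta> \<le> m \<le> \<gamma>\<close>. It remains to bound \<open>(\<lambda> - m)\<^sup>2 = (q\<^sup>2 - 4 p r) / (4 p\<^sup>2)\<close> by \<open>\<alpha>\<close>.

  Bounding \<open>m\<^sup>2\<close> and \<open>- r / p\<close> separately is not enough: when \<open>c' < 0\<close>, the inequality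
  \<open>- r / p \<le> c' / a\<close> may fail, since \<open>p\<close> may exceed \<open>a\<close>. The discriminant is however nonnegative because
  \<open>\<lambda>\<close> is real, so replacing \<open>p\<close> by the smaller \<open>a\<close> increases the whole fraction
  (\<open>discriminant_quotient_antimono\<close>), whatever the sign of \<open>r\<close>. This yields
  \<open>(q / (2 a))\<^sup>2 + c' / a\<close>, and \<open>(q / (2 a))\<^sup>2 \<le> max (\<gamma>\<^sup>2) (\<beta>\<^sup>2)\<close> because the endpoint of
  largest modulus of the interval \<open>[b, b']\<close> is always divided by \<open>2 a\<close>, not \<open>2 a'\<close>, in \<open>\<beta>\<close> or \<open>\<gamma>\<close>.
\<close>

section \<open>Rayleigh's principle for symmetric matrices\<close>

lemma inner_symmetric_matrix:
  fixes S :: "real^'n^'n"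
  assumes "transpose S = S"
  shows "x \<bullet> (S *v y) = y \<bullet> (S *v x)"
  by (metis assms dot_lmul_matrix inner_commute transpose_matrix_vector)

text \<open>
  A nonpositive quadratic form is maximal at each of its zeros, so its gradient \<open>2 T v\<close> vanishes there:
  otherwise a short step in the direction \<open>T v\<close> would make the form positive.
\<close>

lemma nonpos_quadratic_form_zero_imp_kernel:
  fixes T :: "real^'n^'n"
  assumes sym: "transpose T = T"
    and nonpos: "\<And>x. x \<bullet> (T *v x) \<le> 0"
    and zero: "v \<bullet> (T *v v) = 0"
  shows "T *v v = 0"
proof (rule ccontr)
  define y where "y = T *v v"
  assume "T *v v \<noteq> 0"
  then have pos: "y \<bullet> y > 0" by (simp add: y_def)
  define g where "g = y \<bullet> (T *v y)"
  have expand: "2 * t * (y \<bullet> y) + t\<^sup>2 * g \<le> 0" for t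
  proof -
    have "(v + t *\<^sub>R y) \<bullet> (T *v (v + t *\<^sub>R y)) =
        v \<bullet> (T *v v) + t * (v \<bullet> (T *v y)) + t * (y \<bullet> (T *v v)) + t\<^sup>2 * g"
      by (simp add: matrix_vector_right_distrib matrix_vector_mult_scaleR inner_add_left
          inner_add_right algebra_simps power2_eq_square g_def)
    also have "\<dots> = 2 * t * (y \<bullet> y) + t\<^sup>2 * g"
      using inner_symmetric_matrix[OF sym, of v y] zero by (simp add: y_def)
    finally show ?thesis using nonpos by metis
  qed
  have g: "g \<le> 0" using nonpos by (simp add: g_def)
  \<comment> \<open>Up to the shift by 1, which avoids dividing by 0, this step maximises the quadratic in \<open>t\<close>.\<close>
  define t where "t = (y \<bullet> y) / (1 - g)"
  have t: "t > 0" "t * (1 - g) = y \<bullet> y" using g pos by (auto simp: t_def)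
  have "t * (2 * (y \<bullet> y) + t * g) \<le> 0"
    using expand[of t] by (simp add: algebra_simps power2_eq_square)
  then have "2 * (y \<bullet> y) + t * g \<le> 0" using t(1) by (simp add: mult_le_0_iff)
  moreover have "t * g = t - y \<bullet> y" using t(2) by (simp add: algebra_simps)
  ultimately show False using t(1) pos by simp
qed

text \<open>
  Compactness of the unit sphere gives a maximiser \<open>v\<close> of the quadratic form there, with value \<open>k\<close>. The
  form of \<open>S - k I\<close> is then nonpositive and vanishes at \<open>v\<close>, which makes \<open>v\<close> an eigenvector.
\<close>

lemma eigenvalue_dominating_quadratic_form:
  fixes S :: "real^'n^'n"
  assumes sym: "transpose S = S"
  obtains k where "eigenvalue S k" "\<And>x. x \<bullet> (S *v x) \<le> k * (x \<bullet> x)"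
proof -
  have cont: "continuous_on (sphere 0 1) (\<lambda>x. x \<bullet> (S *v x))"
    by (intro continuous_intros matrix_vector_mult_linear_continuous_on)
  have "axis undefined 1 \<in> sphere (0::real^'n) 1" by (simp add: norm_axis_1)
  then have "sphere (0::real^'n) 1 \<noteq> {}" by blast
  then obtain v where v: "norm v = 1" and
    max: "\<And>x. norm x = 1 \<Longrightarrow> x \<bullet> (S *v x) \<le> v \<bullet> (S *v v)"
    using continuous_attains_sup[OF compact_sphere _ cont] by force
  define k where "k = v \<bullet> (S *v v)"
  have bound: "x \<bullet> (S *v x) \<le> k * (x \<bullet> x)" for x
  proof (cases "x = 0")
    case False
    have "inverse (norm x) * (inverse (norm x) * (x \<bullet> (S *v x))) \<le> k"
      using max[of "inverse (norm x) *\<^sub>R x"] False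
      by (simp add: matrix_vector_mult_scaleR k_def)
    then show ?thesis using False
      by (simp add: field_simps power2_norm_eq_inner[symmetric] power2_eq_square)
  qed simp
  define T where "T = S - k *\<^sub>R mat 1"
  have T: "T *v x = S *v x - k *\<^sub>R x" for x
    by (simp add: T_def matrix_vector_mult_diff_rdistrib scaleR_matrix_vector_assoc[symmetric])
  have "T *v v = 0"
  proof (rule nonpos_quadratic_form_zero_imp_kernel)
    have "transpose S $ i $ j = S $ i $ j" for i j by (simp add: sym)
    then show "transpose T = T"
      by (simp add: T_def vec_eq_iff transpose_def mat_def)
    show "x \<bullet> (T *v x) \<le> 0" for x
      using bound[of x] by (simp add: T inner_diff_right)
    show "v \<bullet> (T *v v) = 0"
      using v by (simp add: T inner_diff_right k_def norm_eq_1)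
  qed
  moreover have "v \<noteq> 0" using v by auto
  ultimately have "eigenvalue S k" by (auto simp: eigenvalue_def T)
  then show thesis using bound that by blast
qed

lemma lambda_max_eqI:
  fixes S :: "real^'n^'n"
  assumes "eigenvalue S k" and bound: "\<And>x. x \<bullet> (S *v x) \<le> k * (x \<bullet> x)"
  shows "lambda_max S = k"
  unfolding lambda_max_def
proof (rule Greatest_equality)
  fix l assume "eigenvalue S l"
  then obtain w where "w \<noteq> 0" "S *v w = l *\<^sub>R w" by (auto simp: eigenvalue_def)
  then show "l \<le> k" using bound[of w] by simp
qed fact

lemma lambda_min_eqI:
  fixes S :: "real^'n^'n"
  assumes "eigenvalue S k" and bound: "\<And>x. k * (x \<bullet> x) \<le> x \<bullet> (S *v x)"
  shows "lambda_min S = k"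
  unfolding lambda_min_def
proof (rule Least_equality)
  fix l assume "eigenvalue S l"
  then obtain w where "w \<noteq> 0" "S *v w = l *\<^sub>R w" by (auto simp: eigenvalue_def)
  then show "k \<le> l" using bound[of w] by simp
qed fact

lemma lambda_max_quadratic_form:
  fixes S :: "real^'n^'n"
  assumes "transpose S = S"
  shows "x \<bullet> (S *v x) \<le> lambda_max S * (x \<bullet> x)"
  using eigenvalue_dominating_quadratic_form[OF assms] lambda_max_eqI by metis

lemma matrix_vector_mult_uminus_left: "(- M) *v x = - (M *v x)"
  for M :: "real^'n^'m"
  using matrix_vector_mult_diff_rdistrib[of 0 M x] by simp

lemma lambda_min_quadratic_form:
  fixes S :: "real^'n^'n"
  assumes "transpose S = S"
  shows eigenvalue_lambda_min: "eigenvalue S (lambda_min S)"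
    and lambda_min_quadratic_form_le: "lambda_min S * (x \<bullet> x) \<le> x \<bullet> (S *v x)"
proof -
  have "transpose S $ i $ j = S $ i $ j" for i j by (simp add: assms)
  then have "transpose (- S) = - S" by (simp add: vec_eq_iff transpose_def)
  then obtain k where k: "eigenvalue (- S) k" "\<And>x. x \<bullet> ((- S) *v x) \<le> k * (x \<bullet> x)"
    using eigenvalue_dominating_quadratic_form by blast
  obtain v where v: "v \<noteq> 0" "- (S *v v) = k *\<^sub>R v"
    using k(1) by (auto simp: eigenvalue_def matrix_vector_mult_uminus_left)
  from v(2) have "S *v v = (- k) *\<^sub>R v" by (metis minus_minus scaleR_minus_left)
  then have eig: "eigenvalue S (- k)" using v(1) by (auto simp: eigenvalue_def)
  have bound: "- k * (x \<bullet> x) \<le> x \<bullet> (S *v x)" for x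
    using k(2)[of x] by (simp add: matrix_vector_mult_uminus_left)
  have "lambda_min S = - k" using eig bound by (rule lambda_min_eqI)
  then show "eigenvalue S (lambda_min S)" "lambda_min S * (x \<bullet> x) \<le> x \<bullet> (S *v x)"
    using eig bound by simp_all
qed

section \<open>Quadratic forms of nonsymmetric matrices\<close>

lemma transpose_add_transpose: "transpose (M + transpose M) = M + transpose M"
  for M :: "real^'n^'n"
  by (simp add: vec_eq_iff transpose_def add.commute)

lemma quadratic_form_add_transpose: "x \<bullet> ((M + transpose M) *v x) = 2 * (x \<bullet> (M *v x))"
  for M :: "real^'n^'n"
proof -
  have "x \<bullet> (transpose M *v x) = x \<bullet> (M *v x)"
    by (metis dot_lmul_matrix inner_commute transpose_matrix_vector)
  then show ?thesis
    by (simp add: matrix_vector_mult_add_rdistrib inner_add_right)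
qed

lemma quadratic_form_le_lambda_max:
  fixes M :: "real^'n^'n"
  shows "x \<bullet> (M *v x) \<le> lambda_max (M + transpose M) / 2 * (x \<bullet> x)"
  using lambda_max_quadratic_form[OF transpose_add_transpose, of x M]
  by (simp add: quadratic_form_add_transpose)

lemma quadratic_form_ge_lambda_min:
  fixes M :: "real^'n^'n"
  shows "lambda_min (M + transpose M) / 2 * (x \<bullet> x) \<le> x \<bullet> (M *v x)"
  using lambda_min_quadratic_form_le[OF transpose_add_transpose, of M x]
  by (simp add: quadratic_form_add_transpose)

lemma positive_definite_lambda_min_pos:
  assumes "positive_definite A"
  shows "lambda_min (A + transpose A) > 0"
proof -
  obtain v where v: "v \<noteq> 0"
    "(A + transpose A) *v v = lambda_min (A + transpose A) *\<^sub>R v"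
    using eigenvalue_lambda_min[OF transpose_add_transpose] by (auto simp: eigenvalue_def)
  have "lambda_min (A + transpose A) * (v \<bullet> v) = 2 * (v \<bullet> (A *v v))"
    using quadratic_form_add_transpose[of v A] v(2) by simp
  also have "\<dots> > 0" using assms v(1) by (simp add: positive_definite_def)
  finally show ?thesis by (rule zero_less_mult_pos2) (simp add: v(1))
qed

lemma add_transpose_uminus: "- M + transpose (- M) = - M - transpose M"
  for M :: "real^'n^'n"
  by (simp add: vec_eq_iff transpose_def)

section \<open>Locating the roots of a real quadratic\<close>

text \<open>
  As functions of \<open>p\<close>, the term \<open>q\<^sup>2 / (4 p\<^sup>2)\<close> decreases, but for \<open>r > 0\<close> the term \<open>- r / p\<close> increases.
  In that case the terms cannot be treated separately. Lowering \<open>p\<close> to \<open>a\<close> increases the numerator of the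
  combined fraction, and as the numerator is nonnegative, shrinking the denominator increases the
  fraction further.
\<close>

lemma discriminant_quotient_antimono:
  fixes a p q r :: real
  assumes "0 < a" "a \<le> p" and disc: "0 \<le> q\<^sup>2 - 4 * p * r"
  shows "(q\<^sup>2 - 4 * p * r) / (4 * p\<^sup>2) \<le> (q\<^sup>2 - 4 * a * r) / (4 * a\<^sup>2)"
proof (cases "r \<ge> 0")
  case True
  have "a * r \<le> p * r" using True assms by (intro mult_right_mono)
  moreover have "a\<^sup>2 \<le> p\<^sup>2" using assms by (intro power_mono) auto
  ultimately show ?thesis using assms by (intro frac_le) auto
next
  case False
  have split: "(q\<^sup>2 - 4 * s * r) / (4 * s\<^sup>2) = q\<^sup>2 / (4 * s\<^sup>2) + (- r) / s" if "s > 0" for s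
    using that by (simp add: field_simps power2_eq_square)
  have "a\<^sup>2 \<le> p\<^sup>2" using assms by (intro power_mono) auto
  then have "q\<^sup>2 / (4 * p\<^sup>2) \<le> q\<^sup>2 / (4 * a\<^sup>2)" using assms by (intro divide_left_mono) auto
  moreover have "(- r) / p \<le> (- r) / a" using False assms by (intro divide_left_mono) auto
  ultimately show ?thesis using assms by (simp only: split)
qed

lemma quotient_ge_box_minimum:
  fixes a a' b p s :: real
  assumes "0 < a" "a \<le> p" "p \<le> a'" "b \<le> s"
  shows "(if b > 0 then b / (2 * a') else b / (2 * a)) \<le> s / (2 * p)"
proof -
  have "(if b > 0 then b / (2 * a') else b / (2 * a)) \<le> b / (2 * p)"
    using assms by (auto intro: divide_left_mono divide_left_mono_neg)
  also have "\<dots> \<le> s / (2 * p)" using assms by (intro divide_right_mono) auto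
  finally show ?thesis .
qed

lemma quotient_le_box_maximum:
  fixes a a' b' p s :: real
  assumes "0 < a" "a \<le> p" "p \<le> a'" "s \<le> b'"
  shows "s / (2 * p) \<le> (if b' > 0 then b' / (2 * a) else b' / (2 * a'))"
proof -
  have "s / (2 * p) \<le> b' / (2 * p)" using assms by (intro divide_right_mono) auto
  also have "\<dots> \<le> (if b' > 0 then b' / (2 * a) else b' / (2 * a'))"
    using assms by (auto intro: divide_left_mono divide_left_mono_neg)
  finally show ?thesis .
qed

text \<open>
  The sign of \<open>s\<close> decides which square dominates: a positive \<open>s\<close> forces \<open>b' > 0\<close>
  and a nonpositive one forces \<open>b \<le> 0\<close>, so in each case the dominating quotient has denominator \<open>2 a\<close>.
\<close>

lemma square_le_max_box_squares:
  fixes a a' b b' s :: real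
  assumes "0 < a" "b \<le> s" "s \<le> b'"
  shows "(s / (2 * a))\<^sup>2 \<le> max ((if b' > 0 then b' / (2 * a) else b' / (2 * a'))\<^sup>2)
                              ((if b > 0 then b / (2 * a') else b / (2 * a))\<^sup>2)"
proof (cases "s > 0")
  case True
  then have "(s / (2 * a))\<^sup>2 \<le> (b' / (2 * a))\<^sup>2"
    using assms by (intro power_mono divide_right_mono) auto
  then show ?thesis using True assms by (simp add: le_max_iff_disj)
next
  case False
  then have "(- s / (2 * a))\<^sup>2 \<le> (- b / (2 * a))\<^sup>2"
    using assms by (intro power_mono divide_right_mono divide_nonneg_pos) auto
  then show ?thesis using False assms by (simp add: le_max_iff_disj)
qed

text \<open>
  With \<open>m = - q / (2 p)\<close>, completing the square expresses \<open>(x - m)\<^sup>2\<close> through the discriminant; as a square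
  it also shows that the discriminant is nonnegative.
\<close>

lemma quadratic_root_bounds:
  fixes a a' b b' c' p q r x \<alpha> \<beta> \<gamma> :: real
  assumes a: "0 < a" and p: "a \<le> p" "p \<le> a'" and q: "b \<le> - q" "- q \<le> b'" and r: "- r \<le> c'"
    and \<beta>: "\<beta> = (if b > 0 then b / (2 * a') else b / (2 * a))"
    and \<gamma>: "\<gamma> = (if b' > 0 then b' / (2 * a) else b' / (2 * a'))"
    and \<alpha>: "\<alpha> = max (\<gamma>\<^sup>2) (\<beta>\<^sup>2) + c' / a"
    and root: "p * x\<^sup>2 + q * x + r = 0"
  shows "\<beta> - sqrt \<alpha> \<le> x \<and> x \<le> \<gamma> + sqrt \<alpha>"
proof -
  define m where "m = - q / (2 * p)"
  have "p > 0" using a p by simp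
  have r_eq: "r = - p * x\<^sup>2 - q * x" using root by simp
  have disc: "q\<^sup>2 - 4 * p * r = (2 * p * x + q)\<^sup>2"
    unfolding r_eq by (simp add: power2_eq_square algebra_simps)
  have "x - m = (2 * p * x + q) / (2 * p)"
    using \<open>p > 0\<close> by (simp add: m_def field_simps)
  then have "(x - m)\<^sup>2 = (q\<^sup>2 - 4 * p * r) / (4 * p\<^sup>2)"
    by (simp add: disc power_divide power_mult_distrib)
  also have "\<dots> \<le> (q\<^sup>2 - 4 * a * r) / (4 * a\<^sup>2)"
    using a p(1) by (rule discriminant_quotient_antimono) (simp add: disc)
  also have "\<dots> = (- q / (2 * a))\<^sup>2 + (- r) / a"
    using a by (simp add: field_simps power2_eq_square)
  also have "\<dots> \<le> \<alpha>"
    unfolding \<alpha> \<beta> \<gamma> using a r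
    by (intro add_mono square_le_max_box_squares q divide_right_mono) auto
  finally have "\<bar>x - m\<bar> \<le> sqrt \<alpha>" by (simp add: real_le_rsqrt)
  moreover have "\<beta> \<le> m" unfolding \<beta> m_def using a p q(1) by (rule quotient_ge_box_minimum)
  moreover have "m \<le> \<gamma>" unfolding \<gamma> m_def using a p q(2) by (rule quotient_le_box_maximum)
  ultimately show ?thesis by linarith
qed

section \<open>Bounds for the eigenvalue component of a solution\<close>

theorem theorem8:
  fixes A B C :: "real^'n^'n"
    and x :: "real^'n"
    and lam a a' b b' c' \<alpha> \<beta> \<gamma> :: real
  assumes "positive_definite A"
    and "co_hyperbolic A B C"
    and "a = lambda_min (A + transpose A) / 2"
    and "a' = lambda_max (A + transpose A) / 2"
    and "b = lambda_min (- B - transpose B) / 2"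
    and "b' = lambda_max (- B - transpose B) / 2"
    and "c' = lambda_max (- C - transpose C) / 2"
    and "\<beta> = (if b > 0 then b / (2 * a') else b / (2 * a))"
    and "\<gamma> = (if b' > 0 then b' / (2 * a) else b' / (2 * a'))"
    and "\<alpha> = max (\<gamma>\<^sup>2) (\<beta>\<^sup>2) + c' / a"
    and "qeicp_solution A B C lam x"
  shows "\<beta> - sqrt \<alpha> \<le> lam \<and> lam \<le> \<gamma> + sqrt \<alpha>"
proof -
  define N where "N = x \<bullet> x"
  define p q r where "p = x \<bullet> (A *v x) / N" and "q = x \<bullet> (B *v x) / N" and "r = x \<bullet> (C *v x) / N"
  have "x \<noteq> 0" and
    compl: "x \<bullet> (lam\<^sup>2 *\<^sub>R (A *v x) + lam *\<^sub>R (B *v x) + C *v x) = 0"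
    using assms(11) by (auto simp: qeicp_solution_def Let_def)
  then have N: "N > 0" by (simp add: N_def)
  have "p * lam\<^sup>2 + q * lam + r =
      (x \<bullet> (lam\<^sup>2 *\<^sub>R (A *v x) + lam *\<^sub>R (B *v x) + C *v x)) / N"
    by (simp add: p_def q_def r_def inner_add_right add_divide_distrib mult.commute)
  then have root: "p * lam\<^sup>2 + q * lam + r = 0" using compl by simp
  have "0 < a" using positive_definite_lambda_min_pos[OF assms(1)] assms(3) by simp
  moreover have "a \<le> p" "p \<le> a'"
    using quadratic_form_ge_lambda_min[of A x, folded assms(3) N_def]
      quadratic_form_le_lambda_max[of x A, folded assms(4) N_def] N
    by (simp_all add: p_def pos_le_divide_eq pos_divide_le_eq)
  moreover have "b \<le> - q" "- q \<le> b'"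
    using quadratic_form_ge_lambda_min[of "- B" x, unfolded add_transpose_uminus, folded assms(5) N_def]
      quadratic_form_le_lambda_max[of x "- B", unfolded add_transpose_uminus, folded assms(6) N_def] N
    by (simp_all add: q_def matrix_vector_mult_uminus_left minus_divide_left
        pos_le_divide_eq pos_divide_le_eq del: divide_minus_left)
  moreover have "- r \<le> c'"
    using quadratic_form_le_lambda_max[of x "- C", unfolded add_transpose_uminus, folded assms(7) N_def] N
    by (simp add: r_def matrix_vector_mult_uminus_left minus_divide_left
        pos_divide_le_eq del: divide_minus_left)
  ultimately show ?thesis
    using assms(8,9,10) root by (rule quadratic_root_bounds)
qed

end
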